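(* Let $G$ be a finite group with centre $Z(G)$ such that $\frac{G}{Z(G)} \cong Sz(2)$, where $Sz(2) = \langle a, b : a^5 = b^4 = 1, b^{-1}ab = a^2 \rangle$. Then the Laplacian spectrum of the non-commuting graph $\mathcal{A}_G$ of $G$ is $$\{0, (15|Z(G)|)^{4|Z(G)|-1}, (16|Z(G)|)^{15|Z(G)|-5}, (19|Z(G)|)^5\}.$$
   Context: For a finite non-abelian group $G$, the non-commuting graph $\mathcal{A}_G$ is the simple undirected graph with vertex set $G \setminus Z(G)$ in which two vertices $x,y$ are adjacent if and only if $xy \neq yx$. The Laplacian matrix of a finite graph is $D - A$, with $D$ the degree matrix and $A$ the adjacency matrix. The Laplacian spectrum is the multiset of eigenvalues of the Laplacian matrix; $\{\dots,\alpha^{a},\dots\}$ means the eigenvalue $\alpha$ is listed $a$ times (no exponent means once, exponent $0$ means the entry is absent, and if listed values coincide their multiplicities add). *)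

theory Defs
  imports
    "HOL-Algebra.Coset"
    "HOL-Computational_Algebra.Polynomial"
    "Jordan_Normal_Form.Char_Poly"
    "Graph_Theory.Pair_Digraph"
begin

section \<open>Groups given by generators and relations\<close>

text \<open>The letter \<open>(x, True)\<close> stands for the generator \<open>x\<close> and \<open>(x, False)\<close> for its formal
  inverse. A pair \<open>(u, v)\<close> of words in \<open>R\<close> is the relation \<open>u = v\<close>.\<close>

type_synonym 'g gword = "('g \<times> bool) list"

inductive word_cong :: "('g gword \<times> 'g gword) set \<Rightarrow> 'g gword \<Rightarrow> 'g gword \<Rightarrow> bool"
  for R where
  relation: "(u, v) \<in> R \<Longrightarrow> word_cong R u v"
| cancel: "word_cong R [(x, s), (x, \<not> s)] []"
| refl: "word_cong R u u"
| sym: "word_cong R u v \<Longrightarrow> word_cong R v u"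
| trans: "word_cong R u v \<Longrightarrow> word_cong R v w \<Longrightarrow> word_cong R u w"
| append: "word_cong R u u' \<Longrightarrow> word_cong R v v' \<Longrightarrow> word_cong R (u @ v) (u' @ v')"

definition word_rel :: "('g gword \<times> 'g gword) set \<Rightarrow> 'g gword rel" where
  "word_rel R = {(u, v). word_cong R u v}"

text \<open>All elements of the type \<open>'g\<close> are generators.\<close>

definition presented_group :: "('g gword \<times> 'g gword) set \<Rightarrow> 'g gword set monoid" where
  "presented_group R =
    \<lparr> carrier = UNIV // word_rel R,
      monoid.mult = (\<lambda>X Y. \<Union>u\<in>X. \<Union>v\<in>Y. word_rel R `` {u @ v}),
      one = word_rel R `` {[]} \<rparr>"

lemma equiv_word_rel: "equiv UNIV (word_rel R)"
  by (rule equivI)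
    (auto simp: word_rel_def refl_on_def sym_def trans_def
      intro: word_cong.refl word_cong.sym word_cong.trans)

lemma presented_group_mult:
  "(word_rel R `` {u}) \<otimes>\<^bsub>presented_group R\<^esub> (word_rel R `` {v}) = word_rel R `` {u @ v}"
proof -
  have "congruent2 (word_rel R) (word_rel R) (\<lambda>u v. word_rel R `` {u @ v})"
    by (rule congruent2I'; rule equiv_class_eq[OF equiv_word_rel])
      (auto simp: word_rel_def intro: word_cong.append)
  then show ?thesis
    unfolding presented_group_def
    by (simp add: UN_equiv_class2[OF equiv_word_rel equiv_word_rel])
qed

lemma word_cong_inverse: "word_cong R (rev (map (\<lambda>(x, s). (x, \<not> s)) w) @ w) []"
proof (induction w)
  case Nil
  show ?case by (simp add: word_cong.refl)
next
  case (Cons p w)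
  obtain x s where p: "p = (x, s)" by (cases p)
  have "word_cong R [(x, \<not> s), (x, s)] []"
    using word_cong.cancel[of R x "\<not> s"] by simp
  then have "word_cong R (rev (map (\<lambda>(x, s). (x, \<not> s)) w) @ ([(x, \<not> s), (x, s)] @ w))
      (rev (map (\<lambda>(x, s). (x, \<not> s)) w) @ ([] @ w))"
    by (intro word_cong.append word_cong.refl)
  then show ?case
    using Cons.IH p by (auto intro: word_cong.trans)
qed

lemma group_presented_group: "group (presented_group R)"
proof (rule groupI)
  fix X assume "X \<in> carrier (presented_group R)"
  then obtain u where X: "X = word_rel R `` {u}"
    by (auto simp: presented_group_def elim: quotientE)
  have "word_rel R `` {rev (map (\<lambda>(x, s). (x, \<not> s)) u) @ u} = word_rel R `` {[]}"
    by (rule equiv_class_eq[OF equiv_word_rel]) (simp add: word_rel_def word_cong_inverse)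
  then have "(word_rel R `` {rev (map (\<lambda>(x, s). (x, \<not> s)) u)}) \<otimes>\<^bsub>presented_group R\<^esub> X
      = \<one>\<^bsub>presented_group R\<^esub>"
    unfolding X presented_group_mult by (simp add: presented_group_def)
  moreover have "word_rel R `` {rev (map (\<lambda>(x, s). (x, \<not> s)) u)} \<in> carrier (presented_group R)"
    by (simp add: presented_group_def quotientI)
  ultimately show "\<exists>Y\<in>carrier (presented_group R).
      Y \<otimes>\<^bsub>presented_group R\<^esub> X = \<one>\<^bsub>presented_group R\<^esub>" by blast
next
  have carr: "carrier (presented_group R) = range (\<lambda>u. word_rel R `` {u})"
    by (auto simp: presented_group_def quotient_def)
  have one: "\<one>\<^bsub>presented_group R\<^esub> = word_rel R `` {[]}"
    by (simp add: presented_group_def)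
  show "\<one>\<^bsub>presented_group R\<^esub> \<in> carrier (presented_group R)"
    by (simp add: carr one)
  show "X \<otimes>\<^bsub>presented_group R\<^esub> Y \<in> carrier (presented_group R)"
    if "X \<in> carrier (presented_group R)" "Y \<in> carrier (presented_group R)" for X Y
    using that by (auto simp: carr presented_group_mult)
  show "X \<otimes>\<^bsub>presented_group R\<^esub> Y \<otimes>\<^bsub>presented_group R\<^esub> Z
      = X \<otimes>\<^bsub>presented_group R\<^esub> (Y \<otimes>\<^bsub>presented_group R\<^esub> Z)"
    if "X \<in> carrier (presented_group R)" "Y \<in> carrier (presented_group R)"
      "Z \<in> carrier (presented_group R)" for X Y Z
    using that by (auto simp: carr presented_group_mult)
  show "\<one>\<^bsub>presented_group R\<^esub> \<otimes>\<^bsub>presented_group R\<^esub> X = X"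
    if "X \<in> carrier (presented_group R)" for X
    using that by (auto simp: carr one presented_group_mult)
qed

datatype sz2_gen = Gen_a | Gen_b

abbreviation gen :: "'g \<Rightarrow> 'g gword" where "gen x \<equiv> [(x, True)]"
abbreviation gen_inv :: "'g \<Rightarrow> 'g gword" where "gen_inv x \<equiv> [(x, False)]"

text \<open>\<open>Sz(2) = \<langle>a, b : a^5 = b^4 = 1, b^{-1} a b = a^2\<rangle>\<close>\<close>

definition Sz2 :: "sz2_gen gword set monoid" where
  "Sz2 = presented_group
    {(concat (replicate 5 (gen Gen_a)), []),
     (concat (replicate 4 (gen Gen_b)), []),
     (gen_inv Gen_b @ gen Gen_a @ gen Gen_b, concat (replicate 2 (gen Gen_a)))}"

section \<open>The non-commuting graph\<close>

definition group_centre :: "('a, 'm) monoid_scheme \<Rightarrow> 'a set" where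
  "group_centre G =
    {z \<in> carrier G. \<forall>x\<in>carrier G. z \<otimes>\<^bsub>G\<^esub> x = x \<otimes>\<^bsub>G\<^esub> z}"

text \<open>As in \<^locale>\<open>pair_graph\<close>, an undirected edge is a pair of opposite arcs.\<close>

definition noncommuting_graph :: "('a, 'm) monoid_scheme \<Rightarrow> 'a pair_pre_digraph" where
  "noncommuting_graph G =
    \<lparr> pverts = carrier G - group_centre G,
      parcs = {(x, y). x \<in> carrier G - group_centre G \<and> y \<in> carrier G - group_centre G \<and>
        x \<otimes>\<^bsub>G\<^esub> y \<noteq> y \<otimes>\<^bsub>G\<^esub> x} \<rparr>"

lemma pair_graph_noncommuting_graph:
  assumes "finite (carrier G)"
  shows "pair_graph (noncommuting_graph G)"
proof
  show "finite (parcs (noncommuting_graph G))"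
    by (rule finite_subset[of _ "carrier G \<times> carrier G"])
      (use assms in \<open>auto simp: noncommuting_graph_def\<close>)
qed (use assms in \<open>auto simp: noncommuting_graph_def symmetric_def sym_def\<close>)

section \<open>The Laplacian spectrum of a finite graph\<close>

text \<open>Rows and columns are indexed by the positions in a list \<open>vs\<close> that enumerates the vertices
  without repetition. The in-degree and the out-degree agree for an undirected graph.\<close>

definition degree_matrix :: "'a list \<Rightarrow> 'a pair_pre_digraph \<Rightarrow> complex mat" where
  "degree_matrix vs \<Gamma> = mat (length vs) (length vs)
    (\<lambda>(i, j). if i = j then of_nat (out_degree \<Gamma> (vs ! i)) else 0)"

definition adjacency_matrix :: "'a list \<Rightarrow> 'a pair_pre_digraph \<Rightarrow> complex mat" where
  "adjacency_matrix vs \<Gamma> = mat (length vs) (length vs)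
    (\<lambda>(i, j). if (vs ! i, vs ! j) \<in> parcs \<Gamma> then 1 else 0)"

definition laplacian_matrix :: "'a list \<Rightarrow> 'a pair_pre_digraph \<Rightarrow> complex mat" where
  "laplacian_matrix vs \<Gamma> = degree_matrix vs \<Gamma> - adjacency_matrix vs \<Gamma>"

text \<open>The eigenvalues are counted with algebraic multiplicity, as the roots of the characteristic
  polynomial over the complex numbers.\<close>

definition laplacian_spectrum :: "'a list \<Rightarrow> 'a pair_pre_digraph \<Rightarrow> complex multiset" where
  "laplacian_spectrum vs \<Gamma> = proots (char_poly (laplacian_matrix vs \<Gamma>))"

end

theory Submission
  imports Defs
begin

text \<open>\<open>Sz(2)\<close> is the Frobenius group of order 20. Its nontrivial elements are partitioned into the
  kernel, cyclic of order 5, and the five complements, cyclic of order 4, with the identity removed,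
  and two of them commute exactly if they lie in the same part. Elements of \<open>G\<close> whose images lie in a
  common cyclic subgroup of \<open>G / Z(G)\<close> commute, so the non-commuting graph is complete multipartite
  with one part of size \<open>4 z\<close> and five parts of size \<open>3 z\<close>, where \<open>z\<close> is the order of the centre. The
  Laplacian of a complete multipartite graph is diagonalised explicitly.\<close>

section \<open>The Laplacian spectrum of a complete multipartite graph\<close>

lemma sum_nth_distinct:
  fixes g :: "'a \<Rightarrow> 'b::comm_monoid_add"
  assumes "distinct xs"
  shows "(\<Sum>i = 0..<length xs. g (xs ! i)) = (\<Sum>x\<in>set xs. g x)"
  by (rule sum.reindex_bij_betw) (simp add: atLeast0LessThan bij_betw_nth assms)

lemma sum_singleton_mset: "finite A \<Longrightarrow> (\<Sum>x\<in>A. {#c#}) = replicate_mset (card A) c"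
  by (induction A rule: finite_induct) auto

lemma image_mset_mset_set_eq_sum:
  "finite A \<Longrightarrow> image_mset f (mset_set A) = (\<Sum>x\<in>A. {#f x#})"
  by (induction A rule: finite_induct) auto

text \<open>Invertibility of \<open>P\<close> turns \<open>A * P = P * B\<close> into
  \<open>A = P * B * Q\<close> with \<open>Q\<close> the inverse of \<open>P\<close>. Below, the
  columns of \<open>P\<close> are eigenvectors of \<open>A\<close> and \<open>B\<close> is diagonal,
  so \<open>Q\<close> never has to be computed.\<close>

lemma similar_mat_of_intertwining:
  fixes A :: "'a::field mat"
  assumes A: "A \<in> carrier_mat n n" and B: "B \<in> carrier_mat n n" and P: "P \<in> carrier_mat n n"
    and "det P \<noteq> 0" and AP: "A * P = P * B"
  shows "similar_mat A B"
proof -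
  have "P \<in> Units (ring_mat TYPE('a) n ())"
    using det_non_zero_imp_unit[OF P \<open>det P \<noteq> 0\<close>] .
  then obtain Q where Q: "Q \<in> carrier_mat n n" and QP: "Q * P = 1\<^sub>m n" and PQ: "P * Q = 1\<^sub>m n"
    by (auto simp: Units_def ring_mat_def)
  have "P * B * Q = A * (P * Q)"
    using A P Q by (simp add: AP[symmetric])
  then have "A = P * B * Q"
    using A PQ by simp
  then show ?thesis
    using A B P Q QP PQ by (intro similar_matI[of A B P Q n]) auto
qed

lemma proots_prod_list_linear:
  fixes g :: "'b \<Rightarrow> 'a::idom"
  shows "proots (\<Prod>x\<leftarrow>xs. [:- g x, 1:]) = image_mset g (mset xs)"
proof (induction xs)
  case (Cons y ys)
  have "(\<Prod>x\<leftarrow>ys. [:- g x, 1:]) \<noteq> 0"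
    by (auto simp: prod_list_zero_iff)
  then have "proots ([:- g y, 1:] * (\<Prod>x\<leftarrow>ys. [:- g x, 1:])) = add_mset (g y) (image_mset g (mset ys))"
    by (subst proots_mult) (simp_all add: Cons.IH)
  then show ?case
    by (simp del: mult_pCons_left)
qed simp

text \<open>Since the vectors \<open>f u\<close> are indexed by the vertices themselves, there are
  as many independent eigenvectors as rows. As columns they form an invertible matrix that
  conjugates the Laplacian into the diagonal matrix with entries \<open>ev u\<close>, and similar
  matrices share their characteristic polynomial.\<close>

lemma laplacian_spectrum_eigenbasis:
  fixes f :: "'a \<Rightarrow> 'a \<Rightarrow> complex"
  assumes dist: "distinct vs"
    and eig: "\<And>u v. u \<in> set vs \<Longrightarrow> v \<in> set vs \<Longrightarrow>
      of_nat (out_degree (with_proj \<Gamma>) v) * f u v - (\<Sum>w\<in>{w \<in> set vs. (v, w) \<in> parcs \<Gamma>}. f u w)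
        = ev u * f u v"
    and indep: "\<And>c u. (\<And>v. v \<in> set vs \<Longrightarrow> (\<Sum>u\<in>set vs. c u * f u v) = 0) \<Longrightarrow>
      u \<in> set vs \<Longrightarrow> c u = 0"
  shows "laplacian_spectrum vs \<Gamma> = image_mset ev (mset vs)"
proof -
  define n where "n = length vs"
  define L where "L = laplacian_matrix vs \<Gamma>"
  define P where "P = mat n n (\<lambda>(i, j). f (vs ! j) (vs ! i))"
  define B where "B = mat n n (\<lambda>(i, j). if i = j then ev (vs ! i) else 0)"
  have L: "L \<in> carrier_mat n n"
    by (auto simp: L_def n_def laplacian_matrix_def degree_matrix_def adjacency_matrix_def)
  have P: "P \<in> carrier_mat n n" and B: "B \<in> carrier_mat n n"
    by (simp_all add: P_def B_def)
  have "det P \<noteq> 0"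
  proof
    assume "det P = 0"
    then obtain x where x: "x \<in> carrier_vec n" "x \<noteq> 0\<^sub>v n" "P *\<^sub>v x = 0\<^sub>v n"
      using det_0_iff_vec_prod_zero_field[OF P] by blast
    \<comment> \<open>A kernel vector of \<open>P\<close>, read as a function on vertices instead of
      positions, is a linear relation between the vectors \<open>f u\<close>.\<close>
    define c where "c u = x $ (THE i. i < n \<and> vs ! i = u)" for u
    have c: "c (vs ! i) = x $ i" if "i < n" for i
      unfolding c_def using that dist
      by (intro arg_cong[of _ _ "($) x"] the_equality) (auto simp: n_def nth_eq_iff_index_eq)
    have "(\<Sum>u\<in>set vs. c u * f u v) = 0" if v: "v \<in> set vs" for v
    proof -
      obtain i where i: "i < n" "v = vs ! i"
        using v unfolding n_def by (metis in_set_conv_nth)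
      have "(\<Sum>u\<in>set vs. c u * f u v) = (\<Sum>j = 0..<n. c (vs ! j) * f (vs ! j) v)"
        using sum_nth_distinct[OF dist, of "\<lambda>u. c u * f u v"] by (simp add: n_def)
      also have "\<dots> = (P *\<^sub>v x) $ i"
        using i x(1) c by (auto simp: P_def scalar_prod_def mult.commute intro!: sum.cong)
      finally show ?thesis
        using x(3) i by simp
    qed
    then have "x $ i = 0" if "i < n" for i
      using indep[of c "vs ! i"] c[OF that] that by (simp add: n_def)
    then have "x = 0\<^sub>v n"
      using x(1) by (intro eq_vecI) auto
    with x(2) show False ..
  qed
  moreover have "L * P = P * B"
  proof (rule eq_matI)
    fix i j assume "i < dim_row (P * B)" "j < dim_col (P * B)"
    then have i: "i < n" and j: "j < n"
      by (simp_all add: P_def B_def)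
    have "(L * P) $$ (i, j) = (\<Sum>k = 0..<n. L $$ (i, k) * P $$ (k, j))"
      using i j L P by (auto simp: scalar_prod_def intro!: sum.cong)
    also have "\<dots> = (\<Sum>k = 0..<n. (if k = i then of_nat (out_degree (with_proj \<Gamma>) (vs ! i)) * f (vs ! j) (vs ! i) else 0)
        - (if (vs ! i, vs ! k) \<in> parcs \<Gamma> then f (vs ! j) (vs ! k) else 0))"
      using i j
      by (intro sum.cong) (auto simp: L_def P_def laplacian_matrix_def degree_matrix_def adjacency_matrix_def
          n_def algebra_simps)
    also have "\<dots> = of_nat (out_degree (with_proj \<Gamma>) (vs ! i)) * f (vs ! j) (vs ! i)
        - (\<Sum>k = 0..<n. (if (vs ! i, vs ! k) \<in> parcs \<Gamma> then f (vs ! j) (vs ! k) else 0))"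
      using i by (simp add: sum_subtractf)
    also have "(\<Sum>k = 0..<n. (if (vs ! i, vs ! k) \<in> parcs \<Gamma> then f (vs ! j) (vs ! k) else 0))
        = (\<Sum>w\<in>{w \<in> set vs. (vs ! i, w) \<in> parcs \<Gamma>}. f (vs ! j) w)"
      using sum_nth_distinct[OF dist, of "\<lambda>w. if (vs ! i, w) \<in> parcs \<Gamma> then f (vs ! j) w else 0"]
      by (simp add: n_def flip: sum.inter_filter)
    also have "of_nat (out_degree (with_proj \<Gamma>) (vs ! i)) * f (vs ! j) (vs ! i) - \<dots>
        = ev (vs ! j) * f (vs ! j) (vs ! i)"
      using i j by (intro eig) (auto simp: n_def)
    also have "\<dots> = (\<Sum>k = 0..<n. if k = j then ev (vs ! j) * f (vs ! j) (vs ! i) else 0)"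
      using j by simp
    also have "\<dots> = (\<Sum>k = 0..<n. P $$ (i, k) * B $$ (k, j))"
      using i j by (intro sum.cong) (auto simp: P_def B_def)
    also have "\<dots> = (P * B) $$ (i, j)"
      using i j P B by (auto simp: scalar_prod_def intro!: sum.cong)
    finally show "(L * P) $$ (i, j) = (P * B) $$ (i, j)" .
  qed (use L P B in auto)
  ultimately have "similar_mat L B"
    by (intro similar_mat_of_intertwining[OF L B P])
  then have "char_poly L = char_poly B"
    by (rule char_poly_similar)
  also have "\<dots> = (\<Prod>a\<leftarrow>diag_mat B. [:- a, 1:])"
    by (rule char_poly_upper_triangular[OF B]) (auto simp: B_def)
  also have "diag_mat B = map ev vs"
    by (rule nth_equalityI) (auto simp: diag_mat_def B_def n_def)
  finally show ?thesis
    by (simp add: laplacian_spectrum_def L_def proots_prod_list_linear o_def)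
qed

text \<open>With \<open>N\<close> vertices and blocks of size \<open>m k\<close>, three kinds of
  eigenvectors fill the space. The constants have eigenvalue 0. Vectors constant on blocks with
  total 0 have eigenvalue \<open>N\<close> and leave one dimension fewer than there are blocks.
  Vectors supported in one block \<open>k\<close> with sum 0 have eigenvalue \<open>N - m k\<close>,
  in dimension \<open>m k - 1\<close>.\<close>

lemma complete_multipartite_laplacian_spectrum:
  fixes blk :: "'a \<Rightarrow> 'b"
  assumes dist: "distinct vs"
    and parcs: "parcs \<Gamma> = {(x, y). x \<in> set vs \<and> y \<in> set vs \<and> blk x \<noteq> blk y}"
    and "vs \<noteq> []"
  shows "laplacian_spectrum vs \<Gamma> = {#0#}
    + replicate_mset (card (blk ` set vs) - 1) (of_nat (length vs))
    + (\<Sum>k\<in>blk ` set vs. replicate_mset (card {v \<in> set vs. blk v = k} - 1)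
        (of_nat (length vs - card {v \<in> set vs. blk v = k})))"
proof -
  define V where "V = set vs"
  define C where "C k = {v \<in> V. blk v = k}" for k
  define N where "N = length vs"
  define m where "m k = card (C k)" for k
  have finV [simp]: "finite V" and cardV: "card V = N" and "V \<noteq> {}"
    using dist \<open>vs \<noteq> []\<close> by (simp_all add: V_def N_def distinct_card)
  have finC [simp]: "finite (C k)" for k
    by (simp add: C_def)
  have m_le: "m k \<le> N" for k
    unfolding m_def cardV[symmetric] by (rule card_mono) (auto simp: C_def)
  define rep where "rep k = (SOME v. v \<in> V \<and> blk v = k)" for k
  have rep: "rep k \<in> V \<and> blk (rep k) = k" if "k \<in> blk ` V" for k
    unfolding rep_def by (rule someI_ex) (use that in auto)
  obtain u0 where "u0 \<in> V"
    using \<open>V \<noteq> {}\<close> by blast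
  define k0 where "k0 = blk u0"
  have k0: "k0 \<in> blk ` V"
    using \<open>u0 \<in> V\<close> by (simp add: k0_def)
  have repC: "rep k \<in> C k" if "k \<in> blk ` V" for k
    using rep[OF that] by (simp add: C_def)
  have m_pos: "m k > 0" if "k \<in> blk ` V" for k
    using repC[OF that] by (auto simp: m_def card_gt_0_iff)
  have N_pos: "N > 0"
    using m_pos[OF k0] m_le[of k0] by simp

  define T where "T u \<longleftrightarrow> u = rep (blk u)" for u
  have repT: "u = rep k \<longleftrightarrow> T u \<and> blk u = k" if "k \<in> blk ` V" for u k
    using rep[OF that] by (auto simp: T_def)
  \<comment> \<open>An eigenbasis indexed by the vertices: the representative of the block \<open>k0\<close> carries the
    all-ones vector, that of any other block \<open>k\<close> carries \<open>N 1\<^sub>k - m k\<close>, where \<open>1\<^sub>k\<close> is the indicator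
    of \<open>k\<close>, and every other vertex \<open>u\<close> carries \<open>1\<^sub>u - 1\<^sub>r\<close> with \<open>r\<close> the representative of its block.\<close>
  define f :: "'a \<Rightarrow> 'a \<Rightarrow> complex" where
    "f u v = (if \<not> T u then of_bool (v = u) - of_bool (v = rep (blk u))
      else if blk u = k0 then 1
      else of_nat N * of_bool (blk v = blk u) - of_nat (m (blk u)))" for u v
  define ev :: "'a \<Rightarrow> complex" where
    "ev u = (if \<not> T u then of_nat (N - m (blk u))
      else if blk u = k0 then 0 else of_nat N)" for u

  \<comment> \<open>The neighbours of a vertex form the complement of its block, so the neighbour
    sum in the Laplacian is the total over \<open>V\<close> minus one block sum.\<close>
  have sum_C: "(\<Sum>v\<in>C k. f u v) = (if \<not> T u then 0
      else if blk u = k0 then of_nat (m k)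
      else of_nat N * of_nat (m k) * of_bool (k = blk u) - of_nat (m (blk u)) * of_nat (m k))"
    if "u \<in> V" for u k
  proof -
    have bu: "blk u \<in> blk ` V"
      using that by simp
    have 1: "u \<in> C k \<longleftrightarrow> k = blk u" "rep (blk u) \<in> C k \<longleftrightarrow> k = blk u"
      using that rep[OF bu] by (auto simp: C_def)
    have 2: "(\<Sum>v\<in>C k. of_bool (v = w)) = (of_bool (w \<in> C k) :: complex)" for w
      by (simp add: of_bool_def)
    have 3: "(\<Sum>v\<in>C k. of_bool (blk v = blk u)) = (of_nat (m k) * of_bool (k = blk u) :: complex)"
      by (simp add: C_def m_def of_bool_def)
    show ?thesis
      using 1 2 3 by (auto simp: f_def sum_subtractf m_def simp flip: sum_distrib_left)
  qed
  have sum_V: "(\<Sum>v\<in>V. g v) = (\<Sum>k\<in>blk ` V. \<Sum>v\<in>C k. g v)" for g :: "'a \<Rightarrow> complex"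
    unfolding C_def by (rule sum.image_gen) simp
  have sum_m: "(\<Sum>k\<in>blk ` V. of_nat (m k)) = (of_nat N :: complex)"
    using sum_V[of "\<lambda>_. 1"] by (simp add: cardV m_def)
  have sum_f: "(\<Sum>v\<in>V. f u v) = (if u = rep k0 then of_nat N else 0)" if "u \<in> V" for u
  proof -
    have bu: "blk u \<in> blk ` V"
      using that by simp
    have *: "(\<Sum>k\<in>blk ` V. of_nat N * of_nat (m k) * of_bool (k = blk u))
        = (of_nat N * of_nat (m (blk u)) :: complex)"
      using bu by (simp add: of_bool_def if_distrib cong: if_cong)
    note r = repT[OF k0, of u]
    consider "\<not> T u" | "T u" "blk u = k0" | "T u" "blk u \<noteq> k0"
      by blast
    then show ?thesis
    proof cases
      case 3
      have "(\<Sum>v\<in>V. f u v) = (\<Sum>k\<in>blk ` V. of_nat N * of_nat (m k) * of_bool (k = blk u)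
          - of_nat (m (blk u)) * of_nat (m k))"
        unfolding sum_V sum_C[OF that] using 3 by (intro sum.cong) auto
      also have "\<dots> = 0"
        unfolding sum_subtractf * sum_distrib_left[symmetric] sum_m by simp
      finally show ?thesis
        using 3 r by simp
    next
      case 1
      then have "(\<Sum>v\<in>V. f u v) = (\<Sum>k\<in>blk ` V. 0)"
        unfolding sum_V sum_C[OF that] by (intro sum.cong) auto
      then show ?thesis
        using 1 r by simp
    next
      case 2
      then have "(\<Sum>v\<in>V. f u v) = (\<Sum>k\<in>blk ` V. of_nat (m k))"
        unfolding sum_V sum_C[OF that] by (intro sum.cong) auto
      then show ?thesis
        using 2 sum_m repT[OF k0] by simp
    qed
  qed

  have "laplacian_spectrum vs \<Gamma> = image_mset ev (mset vs)"
  proof (rule laplacian_spectrum_eigenbasis[OF dist])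
    fix u v assume "u \<in> set vs" "v \<in> set vs"
    then have u: "u \<in> V" and v: "v \<in> V"
      by (simp_all add: V_def)
    have nbr: "{w \<in> set vs. (v, w) \<in> parcs \<Gamma>} = V - C (blk v)"
      using v by (auto simp: parcs V_def C_def)
    have "out_arcs (with_proj \<Gamma>) v = Pair v ` {w \<in> set vs. (v, w) \<in> parcs \<Gamma>}"
      by (auto simp: out_arcs_def parcs)
    then have "out_degree (with_proj \<Gamma>) v = card (V - C (blk v))"
      unfolding nbr by (simp add: out_degree_def card_image inj_on_def)
    also have "\<dots> = N - m (blk v)"
      by (subst card_Diff_subset) (auto simp: cardV m_def C_def)
    finally have deg: "of_nat (out_degree (with_proj \<Gamma>) v) = (of_nat N - of_nat (m (blk v)) :: complex)"
      using m_le by (simp add: of_nat_diff)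
    have "(\<Sum>w\<in>V - C (blk v). f u w) = (\<Sum>w\<in>V. f u w) - (\<Sum>w\<in>C (blk v). f u w)"
      by (rule sum_diff) (auto simp: C_def)
    moreover note repT[OF k0, of u]
    moreover have "blk (rep (blk u)) = blk u"
      using rep u by simp
    ultimately have sums: "(\<Sum>w\<in>V - C (blk v). f u w) =
        (if T u \<and> blk u = k0 then of_nat N else 0) - (\<Sum>w\<in>C (blk v). f u w)"
      and blk_rep: "blk (rep (blk u)) = blk u"
      using sum_f[OF u] by simp_all
    consider "\<not> T u" "blk v = blk u" | "\<not> T u" "blk v \<noteq> blk u" | "T u" "blk u = k0"
      | "T u" "blk u \<noteq> k0" "blk v = blk u" | "T u" "blk u \<noteq> k0" "blk v \<noteq> blk u"
      by blast
    then show "of_nat (out_degree (with_proj \<Gamma>) v) * f u v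
        - (\<Sum>w\<in>{w \<in> set vs. (v, w) \<in> parcs \<Gamma>}. f u w) = ev u * f u v"
      unfolding nbr deg sums sum_C[OF u]
    proof cases
      \<comment> \<open>Here \<open>f u v = 0\<close>, as both points where \<open>f u\<close> is
        nonzero lie in the block of \<open>u\<close>.\<close>
      case 2
      then have "v \<noteq> u" "v \<noteq> rep (blk u)"
        using blk_rep by auto
      with 2 show "(of_nat N - of_nat (m (blk v))) * f u v
        - ((if T u \<and> blk u = k0 then of_nat N else 0)
          - (if \<not> T u then 0 else if blk u = k0 then of_nat (m (blk v))
             else of_nat N * of_nat (m (blk v)) * of_bool (blk v = blk u)
               - of_nat (m (blk u)) * of_nat (m (blk v)))) = ev u * f u v"
        by (simp add: f_def)
    qed (use m_le[of "blk u"] in \<open>simp_all add: f_def ev_def of_nat_diff algebra_simps\<close>)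
  next
    fix c u assume c: "\<And>v. v \<in> set vs \<Longrightarrow> (\<Sum>u\<in>set vs. c u * f u v) = 0" and "u \<in> set vs"
    then have u: "u \<in> V"
      by (simp add: V_def)
    have c: "(\<Sum>u\<in>V. c u * f u v) = 0" if "v \<in> V" for v
      using c that by (simp add: V_def)
    \<comment> \<open>Summing a linear relation over all of \<open>V\<close> kills every basis
      vector but the all-ones one; summing it over a block kills the vectors of non-representatives.
      The coefficients therefore vanish in this order: at \<open>rep k0\<close>, at the other
      representatives, elsewhere.\<close>
    have swap: "(\<Sum>u\<in>V. c u * (\<Sum>v\<in>A. f u v)) = 0" if "A \<subseteq> V" for A
    proof -
      have "(\<Sum>u\<in>V. c u * (\<Sum>v\<in>A. f u v)) = (\<Sum>v\<in>A. \<Sum>u\<in>V. c u * f u v)"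
        unfolding sum_distrib_left by (rule sum.swap)
      also have "\<dots> = 0"
        using c that by (intro sum.neutral) auto
      finally show ?thesis .
    qed
    define R where "R = {u \<in> V. T u}"
    have "(\<Sum>u\<in>V. c u * (\<Sum>v\<in>V. f u v)) = (\<Sum>u\<in>V. if u = rep k0 then c u * of_nat N else 0)"
      by (intro sum.cong) (auto simp: sum_f)
    then have c0: "c (rep k0) = 0"
      using swap[of V] rep[OF k0] N_pos by simp
    \<comment> \<open>The constant parts \<open>- m (blk u)\<close> contribute the same
      \<open>S\<close> to every block equation. In block \<open>k0\<close> it stands alone because
      \<open>c (rep k0) = 0\<close>; so \<open>S = 0\<close>, and the other equations isolate
      \<open>c (rep k)\<close>.\<close>
    define S where "S = (\<Sum>u\<in>R. c u * of_nat (m (blk u)))"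
    have block: "of_nat (m k) * (of_nat N * c (rep k) * of_bool (k \<noteq> k0) - S) = 0"
      if k: "k \<in> blk ` V" for k
    proof -
      have "(\<Sum>u\<in>V. c u * (\<Sum>v\<in>C k. f u v)) =
          (\<Sum>u\<in>R. (if u = rep k then of_nat (m k) * of_nat N * c u * of_bool (k \<noteq> k0) else 0)
            - of_nat (m k) * (c u * of_nat (m (blk u))))"
        unfolding R_def sum.inter_filter[OF finV]
      proof (rule sum.cong)
        fix u assume u: "u \<in> V"
        note repT[OF k, of u]
        moreover have "c u = 0" if "T u" "blk u = k0"
          using c0 that repT[OF k0, of u] by simp
        ultimately show "c u * (\<Sum>v\<in>C k. f u v) = (if T u then
          (if u = rep k then of_nat (m k) * of_nat N * c u * of_bool (k \<noteq> k0) else 0)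
            - of_nat (m k) * (c u * of_nat (m (blk u))) else 0)"
          unfolding sum_C[OF u] by (auto simp: algebra_simps)
      qed simp
      also have "\<dots> = of_nat (m k) * (of_nat N * c (rep k) * of_bool (k \<noteq> k0) - S)"
      proof -
        have "rep k \<in> R" "finite R"
          using rep[OF k] repT[OF k, of "rep k"] by (simp_all add: R_def)
        then show ?thesis
          unfolding sum_subtractf S_def[symmetric] sum_distrib_left[symmetric]
          by (simp add: algebra_simps)
      qed
      finally show ?thesis
        using swap[of "C k"] by (simp add: C_def)
    qed
    have "S = 0"
      using block[OF k0] m_pos[OF k0] by simp
    have c_rep: "c (rep k) = 0" if "k \<in> blk ` V" for k
      using block[OF that] m_pos[OF that] N_pos c0 \<open>S = 0\<close> by (cases "k = k0") auto
    show "c u = 0"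
    proof (cases "T u")
      case True
      then show ?thesis
        using c_rep[of "blk u"] repT[of "blk u" u] u by simp
    next
      case False
      \<comment> \<open>Only vectors of non-representatives are left, and at a non-representative
        \<open>u\<close> the only one of them that is nonzero is \<open>f u\<close>.\<close>
      have "(\<Sum>w\<in>V. c w * f w u) = (\<Sum>w\<in>V. if w = u then c w else 0)"
      proof (rule sum.cong)
        fix w assume w: "w \<in> V"
        have "u \<noteq> rep (blk w)"
          using False repT[of "blk w" u] w by simp
        moreover have "c w = 0" if "T w"
          using c_rep[of "blk w"] repT[of "blk w" w] that w by simp
        ultimately show "c w * f w u = (if w = u then c w else 0)"
          using False by (auto simp: f_def)
      qed simp
      then show ?thesis
        using c[OF u] u by simp
    qed
  qed
  also have "\<dots> = (\<Sum>v\<in>V. {#ev v#})"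
    using dist by (simp add: V_def mset_set_set flip: image_mset_mset_set_eq_sum)
  also have "\<dots> = (\<Sum>k\<in>blk ` V. \<Sum>v\<in>C k. {#ev v#})"
    unfolding C_def by (rule sum.image_gen) simp
  also have "\<dots> = (\<Sum>k\<in>blk ` V. {#if k = k0 then 0 else of_nat N#}
      + replicate_mset (m k - 1) (of_nat (N - m k)))"
  proof (rule sum.cong)
    fix k assume k: "k \<in> blk ` V"
    \<comment> \<open>The representative is set apart, which leaves \<open>m k - 1\<close> vertices
      for the eigenvalue \<open>N - m k\<close>.\<close>
    have "(\<Sum>v\<in>C k. {#ev v#}) = {#ev (rep k)#} + (\<Sum>v\<in>C k - {rep k}. {#ev v#})"
      using repC[OF k] by (simp add: sum.remove)
    also have "(\<Sum>v\<in>C k - {rep k}. {#ev v#}) = (\<Sum>v\<in>C k - {rep k}. {#of_nat (N - m k)#})"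
      using repT[OF k] by (intro sum.cong) (auto simp: C_def ev_def)
    also have "\<dots> = replicate_mset (m k - 1) (of_nat (N - m k))"
      using repC[OF k] by (simp add: sum_singleton_mset m_def)
    also have "ev (rep k) = (if k = k0 then 0 else of_nat N)"
      using repT[OF k, of "rep k"] by (simp add: ev_def)
    finally show "(\<Sum>v\<in>C k. {#ev v#}) = {#if k = k0 then 0 else of_nat N#}
      + replicate_mset (m k - 1) (of_nat (N - m k))" .
  qed simp
  also have "\<dots> = (\<Sum>k\<in>blk ` V. {#if k = k0 then 0 else of_nat N#})
      + (\<Sum>k\<in>blk ` V. replicate_mset (m k - 1) (of_nat (N - m k)))"
    by (rule sum.distrib)
  also have "(\<Sum>k\<in>blk ` V. {#if k = k0 then 0 else of_nat N :: complex#})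
      = {#0#} + (\<Sum>k\<in>blk ` V - {k0}. {#of_nat N#})"
    using k0 by (simp add: sum.remove)
  also have "(\<Sum>k\<in>blk ` V - {k0}. {#of_nat N :: complex#})
      = replicate_mset (card (blk ` V) - 1) (of_nat N)"
    using k0 by (simp add: sum_singleton_mset)
  finally show ?thesis
    by (simp add: V_def N_def m_def C_def)
qed

section \<open>The Frobenius group of order 20\<close>

text \<open>The pair \<open>(i, j)\<close> stands for \<open>b\<^sup>i a\<^sup>j\<close>; the product comes from \<open>a\<^sup>j b\<^sup>k = b\<^sup>k a\<^bsup>j 2^k\<^esup>\<close>.\<close>

definition frob20 :: "(nat \<times> nat) monoid" where
  "frob20 = \<lparr> carrier = {..<4} \<times> {..<5},
    monoid.mult = (\<lambda>(i, j) (k, l). ((i + k) mod 4, (j * 2 ^ k + l) mod 5)),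
    one = (0, 0) \<rparr>"

lemma frob20_simps [simp]:
  "carrier frob20 = {..<4} \<times> {..<5}"
  "(i, j) \<otimes>\<^bsub>frob20\<^esub> (k, l) = ((i + k) mod 4, (j * 2 ^ k + l) mod 5)"
  "\<one>\<^bsub>frob20\<^esub> = (0, 0)"
  by (simp_all add: frob20_def)

text \<open>Because \<open>2 ^ 4 = 16\<close> is 1 modulo 5. Associativity of \<open>frob20\<close>
  rests on this: the first component is reduced modulo 4 before it serves as an exponent of
  2.\<close>

lemma two_power_mod_5: "(2::nat) ^ (n mod 4) mod 5 = 2 ^ n mod 5"
proof -
  have "(2::nat) ^ n = (2 ^ 4) ^ (n div 4) * 2 ^ (n mod 4)"
    unfolding power_mult[symmetric] power_add[symmetric] by simp
  moreover have "((2::nat) ^ 4) ^ (n div 4) mod 5 = 1"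
    by (subst power_mod[symmetric]) simp
  ultimately show ?thesis
    by (metis mod_mult_left_eq mult_1)
qed

lemma frob20_assoc:
  "p \<otimes>\<^bsub>frob20\<^esub> q \<otimes>\<^bsub>frob20\<^esub> r = p \<otimes>\<^bsub>frob20\<^esub> (q \<otimes>\<^bsub>frob20\<^esub> r)"
proof -
  obtain i j k l m n where pqr: "p = (i, j)" "q = (k, l)" "r = (m, n)"
    by (cases p, cases q, cases r) blast
  have "((j * 2 ^ k + l) mod 5 * 2 ^ m + n) mod 5 = (j * 2 ^ (k + m) + (l * 2 ^ m + n)) mod 5"
    by (subst mod_add_left_eq[symmetric], subst mod_mult_left_eq)
      (simp add: mod_add_left_eq mod_add_right_eq power_add algebra_simps)
  also have "\<dots> = (j * 2 ^ ((k + m) mod 4) + (l * 2 ^ m + n) mod 5) mod 5"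
  proof (rule mod_add_cong)
    show "j * 2 ^ (k + m) mod 5 = j * 2 ^ ((k + m) mod 4) mod 5"
      by (rule mod_mult_cong) (simp_all add: two_power_mod_5)
  qed simp
  finally show ?thesis
    by (simp add: pqr add.assoc mod_add_left_eq mod_add_right_eq)
qed

text \<open>A list form of the carrier makes the statements about its 20 elements
  executable.\<close>

lemma carrier_frob20_eq_set: "carrier frob20 = set (List.product [0..<4] [0..<5])"
  by auto

lemma frob20_left_inverse:
  "\<forall>p\<in>carrier frob20. \<exists>q\<in>carrier frob20. q \<otimes>\<^bsub>frob20\<^esub> p = \<one>\<^bsub>frob20\<^esub>"
  unfolding carrier_frob20_eq_set by code_simp

lemma group_frob20: "group frob20"
  by (rule groupI) (use frob20_left_inverse in \<open>auto simp: frob20_assoc\<close>)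

text \<open>The block \<open>5\<close> is the Frobenius kernel. Outside of it, \<open>(i, j)\<close> acts on the integers modulo 5
  by \<open>x \<mapsto> 2\<^sup>i x + j\<close>, whose unique fixed point is \<open>- i j\<close>, so that a block \<open>k < 5\<close> consists of the
  nontrivial elements of one point stabiliser, a Frobenius complement.\<close>

definition frob20_block :: "nat \<times> nat \<Rightarrow> nat" where
  "frob20_block = (\<lambda>(i, j). if i = 0 then 5 else i * j mod 5)"

text \<open>An element that commutes with one outside the kernel maps the unique fixed point of the
  latter to itself; a nontrivial one thus lies in the same point stabiliser. The proof simply
  evaluates all pairs.\<close>

lemma frob20_block_eq_if_commute:
  "\<forall>p\<in>carrier frob20. \<forall>q\<in>carrier frob20. p \<noteq> \<one>\<^bsub>frob20\<^esub> \<longrightarrow> q \<noteq> \<one>\<^bsub>frob20\<^esub> \<longrightarrow>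
    p \<otimes>\<^bsub>frob20\<^esub> q = q \<otimes>\<^bsub>frob20\<^esub> p \<longrightarrow> frob20_block p = frob20_block q"
  unfolding carrier_frob20_eq_set by code_simp

lemma card_frob20_block:
  "\<forall>k\<in>{..5}. card {p \<in> carrier frob20 - {\<one>\<^bsub>frob20\<^esub>}. frob20_block p = k} = (if k = 5 then 4 else 3)"
  unfolding carrier_frob20_eq_set by code_simp

lemma frob20_block_image: "frob20_block ` (carrier frob20 - {\<one>\<^bsub>frob20\<^esub>}) = {..5}"
  unfolding carrier_frob20_eq_set by code_simp

text \<open>These are \<open>a\<close> for the kernel and \<open>b a^k\<close> for the complement of
  block \<open>k\<close>; the latter has order 4 and fixes \<open>- k\<close>.\<close>

definition frob20_block_gen :: "nat \<Rightarrow> nat \<times> nat" where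
  "frob20_block_gen k = (if k = 5 then (0, 1) else (1, k))"

text \<open>The exponent can be read off the pair: it is \<open>j\<close> in the kernel and
  \<open>i\<close> outside, where the first component counts the factors \<open>b\<close>. The
  identity falls under block 5 with exponent 0.\<close>

lemma frob20_block_cyclic:
  assumes "p \<in> carrier frob20"
  shows "\<exists>n::nat. p = frob20_block_gen (frob20_block p) [^]\<^bsub>frob20\<^esub> n"
proof -
  obtain i j where p: "p = (i, j)" "i < 4" "j < 5"
    using assms by (cases p) auto
  show ?thesis
  proof (cases "i = 0")
    case True
    have "(0, 1) [^]\<^bsub>frob20\<^esub> n = (0, n mod 5)" for n :: nat
      by (induction n) (simp_all add: mod_Suc_eq)
    then have "p = frob20_block_gen (frob20_block p) [^]\<^bsub>frob20\<^esub> j"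
      using True p by (simp add: frob20_block_def frob20_block_gen_def)
    then show ?thesis ..
  next
    case False
    then have "i = 1 \<or> i = 2 \<or> i = 3"
      using p by auto
    moreover have "j = 0 \<or> j = 1 \<or> j = 2 \<or> j = 3 \<or> j = 4"
      using p by auto
    moreover have "x [^]\<^bsub>frob20\<^esub> (1::nat) = \<one>\<^bsub>frob20\<^esub> \<otimes>\<^bsub>frob20\<^esub> x"
      "x [^]\<^bsub>frob20\<^esub> (2::nat) = \<one>\<^bsub>frob20\<^esub> \<otimes>\<^bsub>frob20\<^esub> x \<otimes>\<^bsub>frob20\<^esub> x"
      "x [^]\<^bsub>frob20\<^esub> (3::nat) = \<one>\<^bsub>frob20\<^esub> \<otimes>\<^bsub>frob20\<^esub> x \<otimes>\<^bsub>frob20\<^esub> x \<otimes>\<^bsub>frob20\<^esub> x" for x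
      by (simp_all only: One_nat_def numeral_2_eq_2 numeral_3_eq_3 nat_pow_Suc nat_pow_0)
    ultimately have "p = frob20_block_gen (frob20_block p) [^]\<^bsub>frob20\<^esub> i"
      unfolding p(1) by (elim disjE) (simp_all add: frob20_block_def frob20_block_gen_def)
    then show ?thesis ..
  qed
qed

section \<open>The presentation of \<open>Sz2\<close>: words evaluated in the Frobenius
  group\<close>

fun frob20_letter :: "sz2_gen \<times> bool \<Rightarrow> nat \<times> nat" where
  "frob20_letter (Gen_a, s) = (0, if s then 1 else 4)"
| "frob20_letter (Gen_b, s) = (if s then 1 else 3, 0)"

primrec frob20_eval :: "sz2_gen gword \<Rightarrow> nat \<times> nat" where
  "frob20_eval [] = (0, 0)"
| "frob20_eval (x # w) = frob20_letter x \<otimes>\<^bsub>frob20\<^esub> frob20_eval w"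

lemma frob20_eval_carrier: "frob20_eval w \<in> carrier frob20"
proof (induction w)
  case (Cons x w)
  then show ?case
    by (cases "frob20_letter x"; cases "frob20_eval w") auto
qed simp

lemma frob20_eval_append:
  "frob20_eval (u @ v) = frob20_eval u \<otimes>\<^bsub>frob20\<^esub> frob20_eval v"
proof (induction u)
  case Nil
  show ?case
    using frob20_eval_carrier[of v] by (cases "frob20_eval v") auto
qed (simp add: frob20_assoc)

text \<open>Evaluation recovers the exponents from the word \<open>b^i a^j\<close>; this will
  separate the classes of the 20 normal forms.\<close>

lemma frob20_eval_normal_form:
  "frob20_eval (replicate i (Gen_b, True) @ replicate j (Gen_a, True)) = (i mod 4, j mod 5)"
proof -
  have "frob20_eval (replicate j (Gen_a, True)) = (0, j mod 5)"
    by (induction j) (simp_all add: mod_Suc_eq)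
  then show ?thesis
    by (induction i) (simp_all add: mod_Suc_eq)
qed

definition sz2_relations :: "(sz2_gen gword \<times> sz2_gen gword) set" where
  "sz2_relations = {(concat (replicate 5 (gen Gen_a)), []),
     (concat (replicate 4 (gen Gen_b)), []),
     (gen_inv Gen_b @ gen Gen_a @ gen Gen_b, concat (replicate 2 (gen Gen_a)))}"

text \<open>The three relations hold in \<open>frob20\<close> for \<open>(0, 1)\<close> and
  \<open>(1, 0)\<close>. This bounds the presented group from below: words with different values lie
  in different classes.\<close>

lemma frob20_eval_cong: "word_cong sz2_relations u v \<Longrightarrow> frob20_eval u = frob20_eval v"
proof (induction rule: word_cong.induct)
  case (relation u v)
  then show ?case
    using frob20_eval_normal_form[of 0 5] frob20_eval_normal_form[of 4 0] frob20_eval_normal_form[of 0 2]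
    by (auto simp: sz2_relations_def)
next
  case (cancel x s)
  show ?case
    by (cases x; cases s) simp_all
qed (simp_all add: frob20_eval_append)

context group
begin

lemma pow_mod_eq:
  assumes "x \<in> carrier G" "x [^] (m::nat) = \<one>"
  shows "x [^] (n mod m) = x [^] n"
proof -
  have "x [^] n = x [^] (m * (n div m)) \<otimes> x [^] (n mod m)"
    using assms(1) by (simp add: nat_pow_mult)
  then show ?thesis
    using assms by (simp flip: nat_pow_pow)
qed

text \<open>Moving \<open>a\<close> to the right past \<open>b\<close> doubles its exponent, hence
  \<open>a^j b^k = b^k a^(j 2^k)\<close>, which is the product rule of \<open>frob20\<close>. The
  orders 4 and 5 absorb the reductions of the exponents.\<close>

lemma frob20_relations_hom:
  assumes a: "a \<in> carrier G" and b: "b \<in> carrier G"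
    and a5: "a [^] (5::nat) = \<one>" and b4: "b [^] (4::nat) = \<one>" and ab: "a \<otimes> b = b \<otimes> a [^] (2::nat)"
  shows "(\<lambda>(i::nat, j::nat). b [^] i \<otimes> a [^] j) \<in> hom frob20 G"
proof (rule homI; clarsimp simp: a b)
  fix i j k l :: nat
  have 1: "a [^] n \<otimes> b = b \<otimes> a [^] (2 * n)" for n :: nat
  proof (induction n)
    case (Suc n)
    have "a [^] Suc n \<otimes> b = a [^] n \<otimes> b \<otimes> a [^] (2::nat)"
      using a b by (simp add: m_assoc ab)
    also have "\<dots> = b \<otimes> a [^] (2 * Suc n)"
      using a b by (simp add: Suc m_assoc nat_pow_mult)
    finally show ?case .
  qed (use a b in simp)
  have 2: "a [^] n \<otimes> b [^] m = b [^] m \<otimes> a [^] (n * 2 ^ m)" for n m :: nat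
  proof (induction m)
    case (Suc m)
    have "a [^] n \<otimes> b [^] Suc m = a [^] n \<otimes> b [^] m \<otimes> b"
      using a b by (simp add: m_assoc)
    also have "\<dots> = b [^] m \<otimes> (a [^] (n * 2 ^ m) \<otimes> b)"
      using a b by (simp add: Suc m_assoc)
    also have "\<dots> = b [^] Suc m \<otimes> a [^] (n * 2 ^ Suc m)"
      using a b unfolding 1 by (simp add: m_assoc mult_ac)
    finally show ?case .
  qed (use a b in simp)
  have "b [^] i \<otimes> a [^] j \<otimes> (b [^] k \<otimes> a [^] l) = b [^] i \<otimes> (a [^] j \<otimes> b [^] k) \<otimes> a [^] l"
    using a b by (simp add: m_assoc)
  also have "\<dots> = b [^] (i + k) \<otimes> a [^] (j * 2 ^ k + l)"
    unfolding 2 using a b by (simp add: m_assoc flip: nat_pow_mult)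
  finally show "b [^] ((i + k) mod 4) \<otimes> a [^] ((j * 2 ^ k + l) mod 5)
      = b [^] i \<otimes> a [^] j \<otimes> (b [^] k \<otimes> a [^] l)"
    using a b a5 b4 by (simp add: pow_mod_eq)
qed

end

text \<open>The map \<open>f\<close> from pairs to \<open>b^i a^j\<close> is a homomorphism because
  \<open>Sz2\<close> satisfies its relations. It is onto because each word represents the image of
  its own evaluation, and injective because evaluation recovers the pair.\<close>

lemma Sz2_iso_frob20: "Sz2 \<cong> frob20"
proof -
  let ?cl = "\<lambda>w. word_rel sz2_relations `` {w}"
  interpret group Sz2
    unfolding Sz2_def by (rule group_presented_group)
  have Sz2: "Sz2 = presented_group sz2_relations"
    by (simp add: Sz2_def sz2_relations_def)
  have carr: "carrier Sz2 = range ?cl"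
    by (auto simp: Sz2 presented_group_def quotient_def)
  have mult: "?cl u \<otimes>\<^bsub>Sz2\<^esub> ?cl v = ?cl (u @ v)" for u v
    unfolding Sz2 by (rule presented_group_mult)
  have one: "\<one>\<^bsub>Sz2\<^esub> = ?cl []"
    by (simp add: Sz2 presented_group_def)
  have cl_eq: "?cl u = ?cl v \<longleftrightarrow> word_cong sz2_relations u v" for u v
    using equiv_class_eq_iff[OF equiv_word_rel, of u v sz2_relations] by (simp add: word_rel_def)
  have pow: "?cl [x] [^]\<^bsub>Sz2\<^esub> n = ?cl (replicate n x)" for x and n :: nat
    by (induction n) (simp_all add: one mult replicate_append_same)
  define a where "a = ?cl (gen Gen_a)"
  define b where "b = ?cl (gen Gen_b)"
  have a: "a \<in> carrier Sz2" and b: "b \<in> carrier Sz2"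
    by (auto simp: carr a_def b_def)
  have a5: "a [^]\<^bsub>Sz2\<^esub> (5::nat) = \<one>\<^bsub>Sz2\<^esub>"
    unfolding a_def pow one cl_eq by (rule word_cong.relation) (simp add: sz2_relations_def)
  have b4: "b [^]\<^bsub>Sz2\<^esub> (4::nat) = \<one>\<^bsub>Sz2\<^esub>"
    unfolding b_def pow one cl_eq by (rule word_cong.relation) (simp add: sz2_relations_def)
  have inv_letter: "?cl [(x, \<not> s)] = inv\<^bsub>Sz2\<^esub> ?cl [(x, s)]" for x s
  proof (rule inv_equality[symmetric])
    show "?cl [(x, \<not> s)] \<otimes>\<^bsub>Sz2\<^esub> ?cl [(x, s)] = \<one>\<^bsub>Sz2\<^esub>"
      using word_cong.cancel[of sz2_relations x "\<not> s"] by (simp add: mult one cl_eq)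
  qed (auto simp: carr)
  have "?cl (gen_inv Gen_b) \<otimes>\<^bsub>Sz2\<^esub> (a \<otimes>\<^bsub>Sz2\<^esub> b) = a [^]\<^bsub>Sz2\<^esub> (2::nat)"
    unfolding a_def b_def pow mult cl_eq
    by (rule word_cong.relation) (simp add: sz2_relations_def)
  then have "inv\<^bsub>Sz2\<^esub> b \<otimes>\<^bsub>Sz2\<^esub> (a \<otimes>\<^bsub>Sz2\<^esub> b) = a [^]\<^bsub>Sz2\<^esub> (2::nat)"
    using inv_letter[of Gen_b True] by (simp add: b_def)
  then have ab: "a \<otimes>\<^bsub>Sz2\<^esub> b = b \<otimes>\<^bsub>Sz2\<^esub> a [^]\<^bsub>Sz2\<^esub> (2::nat)"
    using a b by (metis inv_solve_left m_closed nat_pow_closed)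
  define f where "f = (\<lambda>(i::nat, j::nat). b [^]\<^bsub>Sz2\<^esub> i \<otimes>\<^bsub>Sz2\<^esub> a [^]\<^bsub>Sz2\<^esub> j)"
  have hom: "f \<in> hom frob20 Sz2"
    unfolding f_def using a b a5 b4 ab by (rule frob20_relations_hom)
  \<comment> \<open>Inverse letters are covered as well: the inverses of \<open>a\<close> and
    \<open>b\<close> are \<open>a^4\<close> and \<open>b^3\<close>, the values chosen in
    \<open>frob20_letter\<close>.\<close>
  have letter: "?cl [x] = f (frob20_letter x)" for x
  proof -
    have inv_a: "inv\<^bsub>Sz2\<^esub> a = a [^]\<^bsub>Sz2\<^esub> (4::nat)"
      using a a5 by (intro inv_equality) (simp_all flip: nat_pow_Suc)
    have inv_b: "inv\<^bsub>Sz2\<^esub> b = b [^]\<^bsub>Sz2\<^esub> (3::nat)"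
      using b b4 by (intro inv_equality) (simp_all flip: nat_pow_Suc)
    obtain y s where "x = (y, s)"
      by (cases x)
    then show ?thesis
      using a b inv_a inv_b inv_letter[of y True]
      by (cases y; cases s) (simp_all add: f_def a_def[symmetric] b_def[symmetric])
  qed
  have cl_eval: "?cl w = f (frob20_eval w)" for w
  proof (induction w)
    case Nil
    show ?case
      by (simp add: f_def one mult)
  next
    case (Cons x w)
    have "frob20_letter x \<in> carrier frob20"
      by (cases x rule: frob20_letter.cases) auto
    then have "f (frob20_eval (x # w)) = f (frob20_letter x) \<otimes>\<^bsub>Sz2\<^esub> f (frob20_eval w)"
      using hom_mult[OF hom _ frob20_eval_carrier] by simp
    also have "\<dots> = ?cl (x # w)"
      unfolding letter[symmetric] Cons.IH[symmetric] mult by simp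
    finally show ?case ..
  qed
  have f_word: "f (i, j) = ?cl (replicate i (Gen_b, True) @ replicate j (Gen_a, True))" for i j
    by (simp add: f_def a_def b_def pow mult)
  have "inj_on f (carrier frob20)"
  proof (rule inj_onI; clarify)
    fix i j k l :: nat
    assume "(i, j) \<in> carrier frob20" "(k, l) \<in> carrier frob20" "f (i, j) = f (k, l)"
    then show "i = k \<and> j = l"
      using frob20_eval_cong by (fastforce simp: f_word cl_eq frob20_eval_normal_form)
  qed
  moreover have "f ` carrier frob20 = carrier Sz2"
    using hom_carrier[OF hom] frob20_eval_carrier cl_eval by (auto simp: carr)
  ultimately have iso: "f \<in> iso frob20 Sz2"
    using hom by (simp add: iso_def bij_betw_def)
  then show ?thesis
    using group_frob20 group.iso_sym is_isoI by blast
qed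

section \<open>Groups with central quotient \<open>Sz(2)\<close>\<close>

lemma (in group) group_centre_normal: "group_centre G \<lhd> G"
proof (rule normalI)
  show "subgroup (group_centre G) G"
  proof (rule subgroupI)
    fix z assume z: "z \<in> group_centre G"
    show "inv z \<in> group_centre G"
      unfolding group_centre_def
    proof (clarsimp, intro conjI ballI)
      show "inv z \<in> carrier G"
        using z by (simp add: group_centre_def)
      fix x assume x: "x \<in> carrier G"
      have zG: "z \<in> carrier G" and zx: "z \<otimes> x = x \<otimes> z"
        using z x by (simp_all add: group_centre_def)
      have "inv z \<otimes> x = inv z \<otimes> (x \<otimes> z) \<otimes> inv z"
        using zG x by (simp add: m_assoc)
      also have "\<dots> = x \<otimes> inv z"
        unfolding zx[symmetric] using zG x by (simp flip: m_assoc)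
      finally show "inv z \<otimes> x = x \<otimes> inv z" .
    qed
  next
    fix y z assume "y \<in> group_centre G" "z \<in> group_centre G"
    then have c: "y \<in> carrier G" "z \<in> carrier G"
      and yc: "\<And>x. x \<in> carrier G \<Longrightarrow> y \<otimes> x = x \<otimes> y"
      and zc: "\<And>x. x \<in> carrier G \<Longrightarrow> z \<otimes> x = x \<otimes> z"
      by (auto simp: group_centre_def)
    have "y \<otimes> z \<otimes> x = x \<otimes> (y \<otimes> z)" if x: "x \<in> carrier G" for x
    proof -
      have "y \<otimes> z \<otimes> x = y \<otimes> x \<otimes> z"
        using c x zc[OF x] by (simp add: m_assoc)
      also have "\<dots> = x \<otimes> (y \<otimes> z)"
        using c x yc[OF x] by (simp add: m_assoc)
      finally show ?thesis .
    qed
    then show "y \<otimes> z \<in> group_centre G"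
      using c by (simp add: group_centre_def)
  next
    have "\<one> \<in> group_centre G"
      by (simp add: group_centre_def)
    then show "group_centre G \<noteq> {}"
      by blast
  qed (simp add: group_centre_def)
  show "\<forall>x\<in>carrier G. group_centre G #> x = x <# group_centre G"
    by (auto simp: group_centre_def r_coset_def l_coset_def)
qed

text \<open>The projection followed by the isomorphism: a surjection whose fibres are the cosets of
  \<open>H\<close>, so that arguments about the quotient can be carried out in
  \<open>K\<close>.\<close>

lemma (in normal) hom_from_quotient_iso:
  assumes "G Mod H \<cong> K"
  obtains h where "h \<in> hom G K" "h ` carrier G = carrier K"
    "\<And>x y. x \<in> carrier G \<Longrightarrow> y \<in> carrier G \<Longrightarrow> h x = h y \<longleftrightarrow> H #> x = H #> y"
proof -
  obtain \<phi> where \<phi>: "\<phi> \<in> iso (G Mod H) K"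
    using assms by (auto simp: is_iso_def)
  show thesis
  proof
    show "\<phi> \<circ> (\<lambda>x. H #> x) \<in> hom G K"
      by (rule Group.hom_compose[OF r_coset_hom_Mod]) (use \<phi> in \<open>simp add: iso_def\<close>)
    show "(\<phi> \<circ> (\<lambda>x. H #> x)) ` carrier G = carrier K"
      using \<phi> by (simp only: iso_def bij_betw_def image_comp[symmetric] carrier_FactGroup) simp
    show "(\<phi> \<circ> (\<lambda>x. H #> x)) x = (\<phi> \<circ> (\<lambda>x. H #> x)) y \<longleftrightarrow> H #> x = H #> y"
      if "x \<in> carrier G" "y \<in> carrier G" for x y
      using \<phi> that by (auto simp: iso_def bij_betw_def carrier_FactGroup inj_on_eq_iff)
  qed
qed

text \<open>Both elements are powers of the same \<open>g\<close> up to central factors. In other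
  words, cyclic subgroups of the central quotient have abelian preimages.\<close>

lemma (in group) commute_if_powers_mod_centre:
  fixes m n :: nat
  assumes g: "g \<in> carrier G"
    and x: "x \<in> group_centre G #> g [^] m" and y: "y \<in> group_centre G #> g [^] n"
  shows "x \<otimes> y = y \<otimes> x"
proof -
  obtain u v where u: "u \<in> group_centre G" "x = u \<otimes> g [^] m"
    and v: "v \<in> group_centre G" "y = v \<otimes> g [^] n"
    using x y by (auto simp: r_coset_def)
  have c: "u \<in> carrier G" "v \<in> carrier G"
    and uc: "\<And>a. a \<in> carrier G \<Longrightarrow> u \<otimes> a = a \<otimes> u"
    and vc: "\<And>a. a \<in> carrier G \<Longrightarrow> v \<otimes> a = a \<otimes> v"
    using u v by (auto simp: group_centre_def)
  have "x \<otimes> y = u \<otimes> (g [^] m \<otimes> v) \<otimes> g [^] n"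
    using c g by (simp add: u v m_assoc)
  also have "\<dots> = u \<otimes> v \<otimes> g [^] (m + n)"
    using c g vc[of "g [^] m", symmetric] by (simp add: m_assoc nat_pow_mult)
  also have "\<dots> = v \<otimes> (u \<otimes> g [^] n) \<otimes> g [^] m"
    using c g uc[of v] by (simp add: m_assoc nat_pow_mult add.commute)
  also have "\<dots> = y \<otimes> x"
    using c g uc[of "g [^] n"] by (simp add: u v m_assoc)
  finally show ?thesis .
qed

text \<open>Every fibre of \<open>h\<close> is a coset of \<open>H\<close> and has the size of
  \<open>H\<close>.\<close>

lemma (in subgroup) card_vimage_of_cosets:
  assumes "group G" "finite (carrier G)"
    and h: "h ` carrier G = B"
    and cosets: "\<And>x y. x \<in> carrier G \<Longrightarrow> y \<in> carrier G \<Longrightarrow> h x = h y \<longleftrightarrow> H #> x = H #> y"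
    and "A \<subseteq> B"
  shows "card {x \<in> carrier G. h x \<in> A} = card A * card H"
proof -
  interpret group G by fact
  have fibre: "card {x \<in> carrier G. h x = p} = card H" if p: "p \<in> A" for p
  proof -
    obtain x0 where x0: "x0 \<in> carrier G" "h x0 = p"
      using h p \<open>A \<subseteq> B\<close> by blast
    have "x \<in> H #> x0 \<longleftrightarrow> H #> x = H #> x0" if "x \<in> carrier G" for x
      using that x0 repr_independence[OF _ _ subgroup_axioms] rcos_self[OF that subgroup_axioms] by metis
    moreover have "H #> x0 \<subseteq> carrier G"
      using x0 by (intro r_coset_subset_G subset)
    ultimately have "{x \<in> carrier G. h x = p} = H #> x0"
      using cosets x0 by auto
    moreover have "card H = card (H #> x0)"
      using x0 by (intro card_rcosets_equal rcosetsI subset)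
    ultimately show ?thesis
      by simp
  qed
  have "finite A"
    using h \<open>A \<subseteq> B\<close> \<open>finite (carrier G)\<close> by (metis finite_imageI finite_subset)
  have "{x \<in> carrier G. h x \<in> A} = (\<Union>p\<in>A. {x \<in> carrier G. h x = p})"
    by auto
  also have "card \<dots> = (\<Sum>p\<in>A. card {x \<in> carrier G. h x = p})"
    using \<open>finite A\<close> \<open>finite (carrier G)\<close> by (intro card_UN_disjoint) auto
  also have "\<dots> = card A * card H"
    using fibre by simp
  finally show ?thesis .
qed

section \<open>The blocks of the non-commuting graph and its spectrum\<close>

theorem theorem3p1:
  fixes G :: "('a, 'm) monoid_scheme" and vs :: "'a list"
  assumes "group G"
    and "finite (carrier G)"
    and "(G Mod group_centre G) \<cong> Sz2"
    and "distinct vs"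
    and "set vs = pverts (noncommuting_graph G)"
  shows "laplacian_spectrum vs (noncommuting_graph G) =
    {#0#}
    + replicate_mset (4 * card (group_centre G) - 1) (of_nat (15 * card (group_centre G)))
    + replicate_mset (15 * card (group_centre G) - 5) (of_nat (16 * card (group_centre G)))
    + replicate_mset 5 (of_nat (19 * card (group_centre G)))"
proof -
  interpret group G by fact
  define Z where "Z = group_centre G"
  define z where "z = card Z"
  interpret Z: normal Z G
    unfolding Z_def by (rule group_centre_normal)
  have "G Mod Z \<cong> frob20"
    using assms(3) Sz2_iso_frob20 unfolding Z_def by (rule iso_trans)
  then obtain h where hom: "h \<in> hom G frob20" and surj: "h ` carrier G = carrier frob20"
    and cosets: "\<And>x y. x \<in> carrier G \<Longrightarrow> y \<in> carrier G \<Longrightarrow> h x = h y \<longleftrightarrow> Z #>\<^bsub>G\<^esub> x = Z #>\<^bsub>G\<^esub> y"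
    using Z.hom_from_quotient_iso by blast
  interpret h: group_hom G frob20 h
    using hom by (simp add: group_hom_def group_hom_axioms_def group_frob20 is_group)
  define P where "P = carrier frob20 - {\<one>\<^bsub>frob20\<^esub>}"
  \<comment> \<open>\<open>Z\<close> is the fibre of \<open>h\<close> over the identity, so the
    vertices are the elements with nontrivial image.\<close>
  have V: "set vs = {x \<in> carrier G. h x \<in> P}"
  proof -
    have "x \<in> Z \<longleftrightarrow> h x = \<one>\<^bsub>frob20\<^esub>" if "x \<in> carrier G" for x
      using cosets[OF that one_closed] that coset_join1[OF _ that Z.subgroup_axioms]
        coset_join2[OF that Z.subgroup_axioms] coset_join2[OF one_closed Z.subgroup_axioms] Z.subset one_closed
      by (metis h.hom_one Z.one_closed)
    then show ?thesis
      using assms(5) surj unfolding P_def noncommuting_graph_def Z_def by auto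
  qed
  have card_V: "card {x \<in> carrier G. h x \<in> A} = card A * z" if "A \<subseteq> P" for A
    unfolding z_def using that
    by (intro Z.card_vimage_of_cosets[OF is_group assms(2) surj cosets]) (auto simp: P_def)
  have length_vs: "length vs = 19 * z"
    using card_V[of P] distinct_card[OF assms(4)] by (simp add: V P_def)

  define blk where "blk x = frob20_block (h x)" for x
  \<comment> \<open>Commuting passes from \<open>G\<close> to its image under \<open>h\<close>. It
    does not lift back in general, so for the converse a generator of the common block is lifted to
    \<open>g\<close>; then \<open>x\<close> and \<open>y\<close> lie in cosets of powers of
    \<open>g\<close>.\<close>
  have commute: "x \<otimes>\<^bsub>G\<^esub> y = y \<otimes>\<^bsub>G\<^esub> x \<longleftrightarrow> blk x = blk y" if x: "x \<in> set vs" and y: "y \<in> set vs" for x y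
  proof
    assume "x \<otimes>\<^bsub>G\<^esub> y = y \<otimes>\<^bsub>G\<^esub> x"
    then have "h x \<otimes>\<^bsub>frob20\<^esub> h y = h y \<otimes>\<^bsub>frob20\<^esub> h x"
      using x y V by (metis (no_types, lifting) h.hom_mult mem_Collect_eq)
    then show "blk x = blk y"
      using x y frob20_block_eq_if_commute unfolding V P_def blk_def by blast
  next
    assume eq: "blk x = blk y"
    have "frob20_block_gen (blk x) \<in> carrier frob20"
      by (auto simp: frob20_block_gen_def blk_def frob20_block_def split: prod.splits)
    then obtain g where g: "g \<in> carrier G" "h g = frob20_block_gen (blk x)"
      using surj by (metis imageE)
    have in_coset: "\<exists>n::nat. w \<in> Z #>\<^bsub>G\<^esub> g [^]\<^bsub>G\<^esub> n" if w: "w \<in> set vs" "blk w = blk x" for w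
    proof -
      have wG: "w \<in> carrier G" "h w \<in> carrier frob20"
        using w V by (auto simp: P_def)
      obtain n :: nat where "h w = h g [^]\<^bsub>frob20\<^esub> n"
        using frob20_block_cyclic[OF wG(2)] w(2) g(2) by (auto simp: blk_def)
      then have "h w = h (g [^]\<^bsub>G\<^esub> n)"
        using g by (simp add: h.hom_nat_pow)
      then have "Z #>\<^bsub>G\<^esub> w = Z #>\<^bsub>G\<^esub> g [^]\<^bsub>G\<^esub> n"
        using cosets wG g by simp
      then show ?thesis
        using rcos_self[OF wG(1) Z.subgroup_axioms] by auto
    qed
    show "x \<otimes>\<^bsub>G\<^esub> y = y \<otimes>\<^bsub>G\<^esub> x"
      using in_coset[OF x HOL.refl] in_coset[OF y eq[symmetric]] commute_if_powers_mod_centre[OF g(1)]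
      unfolding Z_def by blast
  qed
  have "P \<subseteq> h ` carrier G"
    unfolding surj P_def by blast
  then have "h ` set vs = P"
    unfolding V by blast
  then have blk_image: "blk ` set vs = {..5}"
    using frob20_block_image unfolding P_def blk_def by (metis image_image)
  have card_blk: "card {v \<in> set vs. blk v = k} = (if k = 5 then 4 else 3) * z" if "k \<in> {..5}" for k
  proof -
    have eq: "{v \<in> set vs. blk v = k} = {x \<in> carrier G. h x \<in> {p \<in> P. frob20_block p = k}}"
      unfolding V blk_def by blast
    have "card {p \<in> P. frob20_block p = k} = (if k = 5 then 4 else 3)"
      unfolding P_def using card_frob20_block that by (rule bspec)
    moreover have "{p \<in> P. frob20_block p = k} \<subseteq> P"
      by blast
    ultimately show ?thesis
      unfolding eq by (simp only: card_V)
  qed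
  have "z > 0"
    using finite_subset[OF Z.subset assms(2)] subgroup.one_closed[OF Z.subgroup_axioms]
    unfolding z_def card_gt_0_iff by blast
  have "vs \<noteq> []"
    using length_vs \<open>z > 0\<close> by auto
  have parcs: "parcs (noncommuting_graph G) = {(x, y). x \<in> set vs \<and> y \<in> set vs \<and> blk x \<noteq> blk y}"
    using commute assms(5) by (auto simp: noncommuting_graph_def)
  \<comment> \<open>The kernel block has \<open>4 * z\<close> of the \<open>19 * z\<close> vertices,
    which gives the eigenvalue \<open>15 * z\<close>. The five others have \<open>3 * z\<close> each
    and give \<open>16 * z\<close> with multiplicity \<open>5 * (3 * z - 1)\<close>. Six blocks
    leave multiplicity 5 for \<open>19 * z\<close>.\<close>
  have "{..5::nat} = insert 5 {..<5}"
    by auto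
  then have blocks: "(\<Sum>k\<in>blk ` set vs. replicate_mset (card {v \<in> set vs. blk v = k} - 1)
        (of_nat (length vs - card {v \<in> set vs. blk v = k}) :: complex))
      = replicate_mset (4 * z - 1) (of_nat (15 * z)) + (\<Sum>k<5::nat. replicate_mset (3 * z - 1) (of_nat (16 * z)))"
    unfolding blk_image using card_blk by (simp add: length_vs)
  have "(\<Sum>k<n. replicate_mset m c) = replicate_mset (n * m) c" for n m and c :: complex
    by (induction n) (simp_all add: multiset_eq_iff)
  then have "(\<Sum>k<5::nat. replicate_mset (3 * z - 1) (of_nat (16 * z) :: complex))
      = replicate_mset (15 * z - 5) (of_nat (16 * z))"
    by (simp add: diff_mult_distrib2)
  then show ?thesis
    unfolding complete_multipartite_laplacian_spectrum[OF assms(4) parcs \<open>vs \<noteq> []\<close>] blocks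
    by (simp add: blk_image length_vs Z_def[symmetric] z_def[symmetric] add_ac)
qed

end
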